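(* Let $\bar{\mathcal M}_\theta:\mathcal X\to\mathcal Y$ be a classifier that is $\alpha$-fair with respect to $(X,\tilde A,Y)$ and the fairness function $h$, where $\tilde A$ shares the same support $[m]=\{1,\dots,m\}$ as $A$. Suppose that for all $a\in[m]$, $x\in\mathcal X$, $y\in\mathcal Y$, the difference between the conditional distributions of $A$ and $\tilde A$ given the event $(X=x,Y=y)$ is upper bounded by $\eta>0$, i.e. $$\left|\Pr(\tilde A=a\mid X=x,Y=y)-\Pr(A=a\mid X=x,Y=y)\right|\le \eta .$$ Then $\bar{\mathcal M}_\theta$ is $\alpha'$-fair with respect to $(X,A,Y)$ and $h$, with $$\alpha'=\frac{\eta\cdot B}{\min_{a\in[m]}\min\{\Pr(\tilde A=a),\Pr(A=a)\}}+\alpha ,$$ where $B=\sup_{y\in\mathcal Y,\,y'\in\mathcal Y}h(y,y')$. Furthermore, if $\Pr(A=a)>\eta$ for all $a\in[m]$, then the fairness bound $\alpha'$ is given by $$\alpha'=\frac{\eta\cdot B}{\min_{a\in[m]}\Pr(A=a)-\eta}+\alpha .$$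
   Context: $X\in\mathcal X$ is a feature vector, $Y\in\mathcal Y$ a class label, $A\in[m]$ a demographic group attribute, and $\tilde A$ a second (privacy-preserving) version of the group attribute. A fairness function $h$ assigns to a prediction and a label a value $h(\mathcal M_\theta(X),Y)\in\mathbb R^c$. A classifier $\mathcal M_\theta:\mathcal X\to\mathcal Y$ is $\alpha$-fair ($\alpha\in\mathbb R_{+}^c$) with respect to a joint distribution $(X,A,Y)$ and a fairness function $h$ if and only if $$\max_{a\in[m]}\left|\mathbb E_{X,Y\mid A=a}[h(\mathcal M_\theta(X),Y)]-\mathbb E_{X,Y}[h(\mathcal M_\theta(X),Y)]\right|\le\alpha ;$$ the same definition with $\tilde A$ in place of $A$ gives $\alpha$-fairness with respect to $(X,\tilde A,Y)$. When $c>1$, absolute values, maxima, suprema and inequalities are read componentwise.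
   Formalization: The fairness function h is assumed componentwise nonnegative and bounded (so that B is finite); for signed h with B = sup h the claim is false, e.g. h = −1[y'=1] gives B = 0 and hence α' = α, which can fail. *)

theory Defs
  imports "HOL-Probability.Probability"
begin

text \<open>
  All vector inequalities, maxima and suprema in \<open>real ^ 'c\<close> are written out componentwise.
  The conditional law given the event \<open>A = a\<close> is the library's \<^const>\<open>uniform_measure\<close>, that is
  \<open>E \<mapsto> M ({A = a} \<inter> E) / M {A = a}\<close>; it is only meaningful when the event has positive
  probability, which users of the definition have to guarantee. Likewise, the maximum requires
  \<open>m \<ge> 1\<close>, which holds as soon as the group attribute takes values in \<open>{1..m}\<close>.
\<close>

definition alpha_fair ::
  "'w measure \<Rightarrow> ('w \<Rightarrow> 'x) \<Rightarrow> ('w \<Rightarrow> nat) \<Rightarrow> ('w \<Rightarrow> 'y) \<Rightarrow> nat \<Rightarrow>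
   ('y \<Rightarrow> 'y \<Rightarrow> real ^ 'c) \<Rightarrow> ('x \<Rightarrow> 'y) \<Rightarrow> real ^ 'c \<Rightarrow> bool" where
  "alpha_fair M X A Y m h f \<alpha> \<longleftrightarrow>
     (\<forall>i. 0 \<le> \<alpha> $ i) \<and>
     (\<forall>i. (MAX a\<in>{1..m}.
            \<bar>(\<integral>w. h (f (X w)) (Y w) \<partial>uniform_measure M {w \<in> space M. A w = a}) $ i
             - (\<integral>w. h (f (X w)) (Y w) \<partial>M) $ i\<bar>) \<le> \<alpha> $ i)"

text \<open>
  \<open>cond_prob_version M N Z E g\<close>: the function \<open>g\<close> is a version of
  \<open>z \<mapsto> Pr(E | Z = z)\<close> for the \<open>N\<close>-valued random variable \<open>Z\<close>, i.e. \<open>g \<circ> Z\<close> is the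
  conditional expectation of the indicator of \<open>E\<close> given the \<open>\<sigma>\<close>-algebra generated by \<open>Z\<close>.
  At atoms of \<open>Z\<close> this forces \<open>g z = Pr(E \<inter> {Z = z}) / Pr(Z = z)\<close>.
\<close>

definition cond_prob_version ::
  "'w measure \<Rightarrow> 'z measure \<Rightarrow> ('w \<Rightarrow> 'z) \<Rightarrow> 'w set \<Rightarrow> ('z \<Rightarrow> real) \<Rightarrow> bool" where
  "cond_prob_version M N Z E g \<longleftrightarrow>
     g \<in> borel_measurable N \<and>
     (AE w in M. g (Z w) = real_cond_exp M (vimage_algebra (space M) Z N) (indicator E) w)"

definition label_sup :: "'y measure \<Rightarrow> ('y \<Rightarrow> 'y \<Rightarrow> real ^ 'c) \<Rightarrow> real ^ 'c" where
  "label_sup MY h = (\<chi> i. SUP (y, y')\<in>space MY \<times> space MY. h y y' $ i)"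

end

theory Submission
  imports Defs
begin

text \<open>
  Fix a component \<open>i\<close> and a group \<open>a\<close>, and let \<open>u \<in> [0, B]\<close> be the \<open>i\<close>-th component of \<open>h\<close> evaluated
  at \<open>(f X, Y)\<close>, a function of \<open>(X, Y)\<close>. Closeness of the conditional probabilities gives
  \<open>\<bar>E[v; A = a] - E[v; A' = a]\<bar> \<le> \<eta> sup \<bar>v\<bar>\<close> for every bounded function \<open>v\<close> of \<open>(X, Y)\<close>; in
  particular \<open>\<bar>P(A = a) - P(A' = a)\<bar> \<le> \<eta>\<close>. Replacing \<open>u\<close> by \<open>v = u - B/2\<close>, which does not change
  differences of conditional expectations but satisfies \<open>\<bar>v\<bar> \<le> B/2\<close>, the numerators and the
  denominators of the two conditional expectations each contribute at most \<open>\<eta> B / (2 P(A = a))\<close>, so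
  that they differ by at most \<open>\<eta> B / P(A = a)\<close>. Both claimed bounds are weaker than this one.
\<close>

lemma integral_uniform_measure:
  fixes u :: "'w \<Rightarrow> 'b::{banach, second_countable_topology}"
  assumes "finite_measure M" and [measurable]: "E \<in> sets M" "u \<in> borel_measurable M"
    and pos: "measure M E > 0"
  shows "(\<integral>w. u w \<partial>uniform_measure M E) = (\<integral>w. indicator E w *\<^sub>R u w \<partial>M) /\<^sub>R measure M E"
proof -
  interpret finite_measure M by fact
  \<comment> \<open>Since \<open>measure M E\<close> is positive and finite, the extended-real
    density of the uniform measure is a real function, so the Bochner integral against it becomes a
    weighted integral over \<open>M\<close>.\<close>
  have "uniform_measure M E = density M (\<lambda>w. ennreal (indicator E w / measure M E))"
    unfolding uniform_measure_def
    by (rule density_cong)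
      (use pos in \<open>auto simp: emeasure_eq_measure ennreal_1[symmetric] divide_ennreal
         simp del: ennreal_1 split: split_indicator\<close>)
  then have "(\<integral>w. u w \<partial>uniform_measure M E) = (\<integral>w. (indicator E w / measure M E) *\<^sub>R u w \<partial>M)"
    using pos by (simp add: integral_density)
  also have "\<dots> = (\<integral>w. (1 / measure M E) *\<^sub>R (indicator E w *\<^sub>R u w) \<partial>M)"
    by simp
  finally show ?thesis
    by (simp only: integral_scaleR_right) (simp add: divide_inverse)
qed

text \<open>\<open>u \<circ> Z\<close> is measurable for the \<sigma>-algebra generated by
  \<open>Z\<close>, so it can be pulled through the conditional expectation of the indicator of
  \<open>E\<close>, which \<open>g \<circ> Z\<close> equals almost everywhere. Boundedness of
  \<open>u\<close> supplies integrability.\<close>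

lemma cond_prob_version_integral:
  assumes "prob_space M" and Z[measurable]: "Z \<in> measurable M N" and E[measurable]: "E \<in> sets M"
    and g: "cond_prob_version M N Z E g"
    and u[measurable]: "u \<in> borel_measurable N" and bd: "\<And>z. z \<in> space N \<Longrightarrow> \<bar>u z\<bar> \<le> c"
  shows "integrable M (\<lambda>w. u (Z w) * g (Z w))"
    and "(\<integral>w. u (Z w) * indicator E w \<partial>M) = (\<integral>w. u (Z w) * g (Z w) \<partial>M)"
proof -
  interpret prob_space M by fact
  let ?F = "vimage_algebra (space M) Z N"
  have "finite_measure_subalgebra M ?F"
    by unfold_locales (use Z in \<open>auto simp: subalgebra_def sets_vimage_algebra2 measurable_def\<close>)
  then interpret finite_measure_subalgebra M ?F .
  have ZF: "Z \<in> measurable ?F N"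
    using Z by (intro measurable_vimage_algebra1) (auto simp: measurable_def)
  have [measurable]: "g \<in> borel_measurable N" using g by (simp add: cond_prob_version_def)
  have uF: "(\<lambda>w. u (Z w)) \<in> borel_measurable ?F"
    using measurable_compose[OF ZF u] .
  have int: "integrable M (\<lambda>w. u (Z w) * indicator E w)"
  proof (rule integrable_const_bound[where B = "\<bar>c\<bar>"])
    show "AE w in M. norm (u (Z w) * indicator E w) \<le> \<bar>c\<bar>"
      using bd measurable_space[OF Z] by (fastforce split: split_indicator)
  qed simp
  have ae: "AE w in M. u (Z w) * real_cond_exp M ?F (indicator E) w = u (Z w) * g (Z w)"
    using g by (auto simp: cond_prob_version_def)
  note c = real_cond_exp_intg[OF int uF]
  show "integrable M (\<lambda>w. u (Z w) * g (Z w))"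
    using c(1) by (subst integrable_cong_AE[THEN arg_cong, symmetric, OF _ _ ae]) simp_all
  show "(\<integral>w. u (Z w) * indicator E w \<partial>M) = (\<integral>w. u (Z w) * g (Z w) \<partial>M)"
    using c(2) integral_cong_AE[OF _ _ ae] by simp
qed

text \<open>With the indicators replaced by \<open>g\<close> and \<open>g'\<close>, the integrands
  differ by \<open>u * (g - g')\<close>, which is pointwise at most \<open>c * \<eta>\<close>, and
  \<open>M\<close> has total mass 1. With suitable \<open>u\<close> this serves both numerators and
  denominators of conditional expectations.\<close>

lemma cond_prob_version_integral_diff_le:
  assumes M: "prob_space M" and Z[measurable]: "Z \<in> measurable M N"
    and E: "E \<in> sets M" "E' \<in> sets M"
    and g: "cond_prob_version M N Z E g" "cond_prob_version M N Z E' g'"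
    and close: "\<And>z. z \<in> space N \<Longrightarrow> \<bar>g' z - g z\<bar> \<le> \<eta>"
    and u[measurable]: "u \<in> borel_measurable N" and bd: "\<And>z. z \<in> space N \<Longrightarrow> \<bar>u z\<bar> \<le> c"
  shows "\<bar>(\<integral>w. u (Z w) * indicator E w \<partial>M) - (\<integral>w. u (Z w) * indicator E' w \<partial>M)\<bar> \<le> c * \<eta>"
proof -
  interpret prob_space M by fact
  note 1 = cond_prob_version_integral[OF M Z E(1) g(1) u bd]
  note 2 = cond_prob_version_integral[OF M Z E(2) g(2) u bd]
  have "(\<integral>w. u (Z w) * indicator E w \<partial>M) - (\<integral>w. u (Z w) * indicator E' w \<partial>M)
      = (\<integral>w. u (Z w) * g (Z w) - u (Z w) * g' (Z w) \<partial>M)"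
    using 1 2 by simp
  also have "\<bar>\<dots>\<bar> \<le> (\<integral>w. \<bar>u (Z w) * g (Z w) - u (Z w) * g' (Z w)\<bar> \<partial>M)"
    by (rule integral_abs_bound)
  also have "\<dots> \<le> (\<integral>w. c * \<eta> \<partial>M)"
  proof (rule integral_mono)
    fix w assume "w \<in> space M"
    then have z: "Z w \<in> space N" using measurable_space[OF Z] by simp
    have "\<bar>u (Z w) * g (Z w) - u (Z w) * g' (Z w)\<bar> = \<bar>u (Z w)\<bar> * \<bar>g' (Z w) - g (Z w)\<bar>"
      by (simp add: abs_mult[symmetric] right_diff_distrib abs_minus_commute)
    also have "\<dots> \<le> c * \<eta>"
      using bd[OF z] close[OF z] by (intro mult_mono) auto
    finally show "\<bar>u (Z w) * g (Z w) - u (Z w) * g' (Z w)\<bar> \<le> c * \<eta>" .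
  qed (use 1 2 in auto)
  finally show ?thesis by (simp add: prob_space)
qed

lemma cond_expectation_diff_le:
  assumes M: "prob_space M" and Z[measurable]: "Z \<in> measurable M N"
    and E[measurable]: "E \<in> sets M" "E' \<in> sets M"
    and g: "cond_prob_version M N Z E g" "cond_prob_version M N Z E' g'"
    and close: "\<And>z. z \<in> space N \<Longrightarrow> \<bar>g' z - g z\<bar> \<le> \<eta>"
    and u[measurable]: "u \<in> borel_measurable N"
    and bd: "\<And>z. z \<in> space N \<Longrightarrow> 0 \<le> u z" "\<And>z. z \<in> space N \<Longrightarrow> u z \<le> B"
    and pos: "measure M E > 0" "measure M E' > 0"
  shows "\<bar>(\<integral>w. u (Z w) * indicator E w \<partial>M) / measure M E
        - (\<integral>w. u (Z w) * indicator E' w \<partial>M) / measure M E'\<bar> \<le> \<eta> * B / measure M E"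
proof -
  interpret prob_space M by fact
  \<comment> \<open>Centring at the midpoint of \<open>[0, B]\<close> halves the sup norm; the same
    estimate applied directly to \<open>u\<close> would lose a factor 2.\<close>
  define v where "v = (\<lambda>z. u z - B / 2)"
  define P P' where "P = measure M E" and "P' = measure M E'"
  define I where "I w D = (\<integral>x. w (Z x) * indicator D x \<partial>M)" for w :: "'b \<Rightarrow> real" and D
  have [measurable]: "v \<in> borel_measurable N" by (simp add: v_def)
  have v_bd: "\<bar>v z\<bar> \<le> B / 2" if "z \<in> space N" for z
    using bd[OF that] by (simp add: v_def abs_le_iff field_simps)
  have B: "0 \<le> B"
    using bd not_empty measurable_space[OF Z] by (meson all_not_in_conv order_trans)
  have P: "P > 0" "P' > 0" using pos by (simp_all add: P_def P'_def)
  have int_ind: "integrable M (\<lambda>x. B / 2 * indicator D x)" if "D \<in> sets M" for D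
    by (intro integrable_mult_right integrable_real_indicator) (use that in \<open>auto simp: less_top[symmetric]\<close>)
  \<comment> \<open>After division by \<open>measure M D\<close> the shift is the constant
    \<open>B / 2\<close>, the same for \<open>E\<close> and \<open>E'\<close>, so it cancels in the
    difference of the quotients.\<close>
  have Iu: "I u D = I v D + B / 2 * measure M D" if [measurable]: "D \<in> sets M" for D
  proof -
    have "integrable M (\<lambda>x. v (Z x) * indicator D x)"
    proof (rule integrable_const_bound[where B = "B / 2"])
      show "AE w in M. norm (v (Z w) * indicator D w) \<le> B / 2"
        using v_bd measurable_space[OF Z] B by (auto split: split_indicator)
    qed simp
    moreover note int_ind[OF that]
    ultimately have "I v D + (\<integral>x. B / 2 * indicator D x \<partial>M)
        = (\<integral>x. v (Z x) * indicator D x + B / 2 * indicator D x \<partial>M)"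
      unfolding I_def by (rule Bochner_Integration.integral_add[symmetric])
    also have "\<dots> = I u D"
      unfolding I_def v_def by (intro Bochner_Integration.integral_cong) (auto simp: algebra_simps)
    finally show ?thesis by simp
  qed
  have vdiff: "\<bar>I v E - I v E'\<bar> \<le> B / 2 * \<eta>"
    unfolding I_def
    by (rule cond_prob_version_integral_diff_le[OF M Z E g close _ v_bd]) simp_all
  \<comment> \<open>The constant test function 1 turns the estimate into one for the probabilities
    of the two events.\<close>
  have "\<bar>I (\<lambda>_. 1) E - I (\<lambda>_. 1) E'\<bar> \<le> 1 * \<eta>"
    unfolding I_def
    by (rule cond_prob_version_integral_diff_le[OF M Z E g close]) simp_all
  then have Pdiff: "\<bar>P' - P\<bar> \<le> \<eta>" by (simp add: I_def P_def P'_def abs_minus_commute)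
  have vE': "\<bar>I v E'\<bar> \<le> B / 2 * P'"
  proof -
    have "\<bar>I v E'\<bar> \<le> (\<integral>x. \<bar>v (Z x) * indicator E' x\<bar> \<partial>M)"
      unfolding I_def by (rule integral_abs_bound)
    also have "\<dots> \<le> (\<integral>x. B / 2 * indicator E' x \<partial>M)"
      by (rule integral_mono')
        (use int_ind[OF E(2)] v_bd measurable_space[OF Z] B in \<open>auto split: split_indicator\<close>)
    finally show ?thesis by (simp add: P'_def)
  qed
  have "I u E / P - I u E' / P' = I v E / P - I v E' / P'"
    using P by (simp add: Iu P_def P'_def add_divide_distrib)
  \<comment> \<open>This splitting leaves \<open>P'\<close> only inside the mean
    \<open>I v E' / P'\<close>, which is at most \<open>B / 2\<close> in absolute value however
    small \<open>P'\<close> is. Hence only \<open>P\<close> remains in the denominator of the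
    bound.\<close>
  also have "\<dots> = (I v E - I v E') / P + I v E' / P' * ((P' - P) / P)"
    using P by (simp add: field_simps)
  also have "\<bar>\<dots>\<bar> \<le> \<bar>I v E - I v E'\<bar> / P + \<bar>I v E'\<bar> / P' * (\<bar>P' - P\<bar> / P)"
    using P by (intro order_trans[OF abs_triangle_ineq]) (simp add: abs_mult)
  also have "\<dots> \<le> B / 2 * \<eta> / P + B / 2 * (\<eta> / P)"
    using P vdiff Pdiff vE' B
    by (intro add_mono mult_mono divide_right_mono) (auto simp: pos_divide_le_eq)
  also have "\<dots> = \<eta> * B / P" by (simp add: field_simps)
  finally show ?thesis by (simp add: I_def P_def P'_def)
qed

theorem theorem1:
  fixes M :: "'w measure" and MX :: "'x measure" and MY :: "'y measure"
    and X :: "'w \<Rightarrow> 'x" and Y :: "'w \<Rightarrow> 'y" and A A' :: "'w \<Rightarrow> nat"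
    and m :: nat and h :: "'y \<Rightarrow> 'y \<Rightarrow> real ^ 'c" and f :: "'x \<Rightarrow> 'y"
    and p p' :: "nat \<Rightarrow> 'x \<times> 'y \<Rightarrow> real" and \<alpha> :: "real ^ 'c" and \<eta> :: real
  assumes "prob_space M"
    and "X \<in> measurable M MX" and "Y \<in> measurable M MY"
    and "A \<in> measurable M (count_space {1..m})" and "A' \<in> measurable M (count_space {1..m})"
    and supp: "\<And>a. a \<in> {1..m} \<Longrightarrow> \<P>(w in M. A w = a) > 0"
    and supp': "\<And>a. a \<in> {1..m} \<Longrightarrow> \<P>(w in M. A' w = a) > 0"
    and "f \<in> measurable MX MY"
    and "(\<lambda>(y, y'). h y y') \<in> borel_measurable (MY \<Otimes>\<^sub>M MY)"
    and h_nonneg: "\<And>y y' i. y \<in> space MY \<Longrightarrow> y' \<in> space MY \<Longrightarrow> 0 \<le> h y y' $ i"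
    and h_bdd: "\<And>i. bdd_above ((\<lambda>(y, y'). h y y' $ i) ` (space MY \<times> space MY))"
    and cond_A: "\<And>a. a \<in> {1..m} \<Longrightarrow>
        cond_prob_version M (MX \<Otimes>\<^sub>M MY) (\<lambda>w. (X w, Y w)) {w \<in> space M. A w = a} (p a)"
    and cond_A': "\<And>a. a \<in> {1..m} \<Longrightarrow>
        cond_prob_version M (MX \<Otimes>\<^sub>M MY) (\<lambda>w. (X w, Y w)) {w \<in> space M. A' w = a} (p' a)"
    and "\<eta> > 0"
    and close: "\<And>a x y. a \<in> {1..m} \<Longrightarrow> x \<in> space MX \<Longrightarrow> y \<in> space MY \<Longrightarrow>
        \<bar>p' a (x, y) - p a (x, y)\<bar> \<le> \<eta>"
    and fair: "alpha_fair M X A' Y m h f \<alpha>"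
  shows "alpha_fair M X A Y m h f
           ((\<eta> *\<^sub>R label_sup MY h)
              /\<^sub>R (MIN a\<in>{1..m}. min (\<P>(w in M. A' w = a)) (\<P>(w in M. A w = a))) + \<alpha>) \<and>
         ((\<forall>a\<in>{1..m}. \<P>(w in M. A w = a) > \<eta>) \<longrightarrow>
           alpha_fair M X A Y m h f
             ((\<eta> *\<^sub>R label_sup MY h)
                /\<^sub>R ((MIN a\<in>{1..m}. \<P>(w in M. A w = a)) - \<eta>) + \<alpha>))"
proof -
  interpret prob_space M by fact
  note [measurable] = assms(2-5,8,9)
  let ?N = "MX \<Otimes>\<^sub>M MY" and ?Z = "\<lambda>w. (X w, Y w)" and ?B = "label_sup MY h"
  let ?H = "\<lambda>w. h (f (X w)) (Y w)"
  let ?E = "\<lambda>A a. {w \<in> space M. A w = a}"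
  define D where "D A a i = \<bar>(\<integral>w. ?H w \<partial>uniform_measure M (?E A a)) $ i - (\<integral>w. ?H w \<partial>M) $ i\<bar>"
    for A :: "'w \<Rightarrow> nat" and a i
  have fairI: "alpha_fair M X C Y m h f \<beta>
      \<longleftrightarrow> (\<forall>i. 0 \<le> \<beta> $ i) \<and> (\<forall>i. (MAX a\<in>{1..m}. D C a i) \<le> \<beta> $ i)" for C \<beta>
    unfolding alpha_fair_def D_def ..
  \<comment> \<open>A sample point \<open>w0\<close> yields a group \<open>A w0\<close>, so that the
    maxima and minima range over a nonempty set, and a label \<open>Y w0\<close>, so that the
    supremum is nonnegative.\<close>
  have "\<exists>w. w \<in> space M" using not_empty by blast
  then obtain w0 where w0: "w0 \<in> space M" ..
  have m: "{1..m} \<noteq> {}" using measurable_space[OF assms(4) w0] by auto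
  have h_le: "h y y' $ i \<le> ?B $ i" if "y \<in> space MY" "y' \<in> space MY" for y y' i
    using cSUP_upper[OF _ h_bdd, of "(y, y')" i] that by (simp add: label_sup_def)
  have "Y w0 \<in> space MY" using measurable_space[OF assms(3) w0] .
  then have B: "0 \<le> ?B $ i" for i using h_nonneg h_le by (meson order_trans)
  have [measurable]: "?E A a \<in> sets M" "?E A' a \<in> sets M" if "a \<in> {1..m}" for a
    using measurable_sets[OF assms(4), of "{a}"] measurable_sets[OF assms(5), of "{a}"] that
    by (auto simp: vimage_def Int_def conj_commute)
  have Hm: "?H \<in> borel_measurable M"
  proof -
    have "(\<lambda>w. (f (X w), Y w)) \<in> measurable M (MY \<Otimes>\<^sub>M MY)" by simp
    from measurable_compose[OF this assms(9)] show ?thesis by simp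
  qed
  have um: "(\<lambda>z. h (f (fst z)) (snd z) $ i) \<in> borel_measurable ?N" for i
  proof -
    have "(\<lambda>z. (f (fst z), snd z)) \<in> measurable ?N (MY \<Otimes>\<^sub>M MY)" by simp
    from measurable_compose[OF this assms(9)]
    have *: "(\<lambda>z. h (f (fst z)) (snd z)) \<in> borel_measurable ?N" by simp
    have "(\<lambda>v :: real ^ 'c. v $ i) \<in> borel_measurable borel"
      by (intro borel_measurable_continuous_onI continuous_intros)
    from measurable_compose[OF * this] show ?thesis .
  qed
  have Hspace: "f (X w) \<in> space MY" "Y w \<in> space MY" if "w \<in> space M" for w
    using that measurable_space[OF assms(8)] measurable_space[OF assms(2)]
      measurable_space[OF assms(3)] by auto
  have comp: "(\<integral>w. ?H w \<partial>uniform_measure M E) $ i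
      = (\<integral>w. ?H w $ i * indicator E w \<partial>M) / measure M E"
    if [measurable]: "E \<in> sets M" and pos: "measure M E > 0" for E i
  proof -
    \<comment> \<open>Integrability lets the coordinate projection pass through the vector integral.
      The norm is dominated by the sum of the coordinates, each lying between 0 and its
      supremum.\<close>
    have int: "integrable M (\<lambda>w. indicator E w *\<^sub>R ?H w)"
    proof (rule integrable_const_bound[where B = "\<Sum>i\<in>UNIV. ?B $ i"])
      have "norm (?H w) \<le> (\<Sum>i\<in>UNIV. ?B $ i)" if "w \<in> space M" for w
        using Hspace[OF that] h_nonneg h_le
        by (intro order_trans[OF norm_le_l1_cart] sum_mono) simp
      then show "AE w in M. norm (indicator E w *\<^sub>R ?H w) \<le> (\<Sum>i\<in>UNIV. ?B $ i)"
        using B by (auto split: split_indicator simp: sum_nonneg)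
    qed (use Hm in simp)
    have "(\<integral>w. indicator E w *\<^sub>R ?H w \<partial>M) $ i = (\<integral>w. (indicator E w *\<^sub>R ?H w) $ i \<partial>M)"
      by (rule integral_bounded_linear[OF bounded_linear_vec_nth int, symmetric])
    then show ?thesis
      by (simp add: integral_uniform_measure[OF finite_measure_axioms that(1) Hm pos]
          divide_inverse mult.commute)
  qed
  \<comment> \<open>Triangle inequality through the conditional expectation given
    \<open>A' = a\<close>: its distance from the overall mean is at most \<alpha> by fairness, and
    its distance from the one given \<open>A = a\<close> is bounded by the lemma above.\<close>
  have key: "D A a i \<le> \<eta> * ?B $ i / \<P>(w in M. A w = a) + \<alpha> $ i" if a: "a \<in> {1..m}" for a i
  proof -
    have "D A' a i \<le> (MAX a\<in>{1..m}. D A' a i)" using a by (intro Max_ge) auto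
    also have "\<dots> \<le> \<alpha> $ i" using fair by (simp add: fairI)
    finally have D': "D A' a i \<le> \<alpha> $ i" .
    have "\<bar>(\<integral>w. ?H w $ i * indicator (?E A a) w \<partial>M) / measure M (?E A a)
        - (\<integral>w. ?H w $ i * indicator (?E A' a) w \<partial>M) / measure M (?E A' a)\<bar>
        \<le> \<eta> * ?B $ i / measure M (?E A a)"
    proof (rule cond_expectation_diff_le[where Z = ?Z and N = ?N and g = "p a" and g' = "p' a"
          and u = "\<lambda>z. h (f (fst z)) (snd z) $ i", simplified])
      fix z assume "z \<in> space ?N"
      then have z: "fst z \<in> space MX" "snd z \<in> space MY" by (auto simp: space_pair_measure)
      then have fz: "f (fst z) \<in> space MY" using measurable_space[OF assms(8)] by auto
      show "\<bar>p' a z - p a z\<bar> \<le> \<eta>" using close[OF a z] by simp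
      show "0 \<le> h (f (fst z)) (snd z) $ i" "h (f (fst z)) (snd z) $ i \<le> ?B $ i"
        using fz z h_nonneg h_le by auto
    qed (use a cond_A cond_A' supp supp' um prob_space_axioms in auto)
    with D' show ?thesis
      using a supp supp' unfolding D_def by (simp add: comp)
  qed
  \<comment> \<open>As \<eta> and the supremum are nonnegative, lowering the denominator only
    weakens the bound. Any positive \<open>q\<close> below all \<open>Pr(A = a)\<close> is thus
    admissible, and both claims are choices of \<open>q\<close>.\<close>
  have concl: "alpha_fair M X A Y m h f ((\<eta> *\<^sub>R ?B) /\<^sub>R q + \<alpha>)"
    if "q > 0" and q: "\<And>a. a \<in> {1..m} \<Longrightarrow> q \<le> \<P>(w in M. A w = a)" for q
  proof -
    have "0 \<le> \<alpha> $ i" for i using fair by (simp add: fairI)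
    moreover have "D A a i \<le> ((\<eta> *\<^sub>R ?B) /\<^sub>R q + \<alpha>) $ i" if "a \<in> {1..m}" for a i
    proof -
      have "\<eta> * ?B $ i / \<P>(w in M. A w = a) \<le> \<eta> * ?B $ i / q"
        using \<open>q > 0\<close> q[OF that] \<open>\<eta> > 0\<close> B by (intro divide_left_mono) auto
      with key[OF that, of i] show ?thesis by (simp add: divide_inverse mult_ac)
    qed
    ultimately show ?thesis
      using m \<open>q > 0\<close> \<open>\<eta> > 0\<close> B unfolding fairI by (subst Max_le_iff) auto
  qed
  show ?thesis
  proof (intro conjI impI concl)
    let ?q = "\<lambda>a. min (\<P>(w in M. A' w = a)) (\<P>(w in M. A w = a))"
    show "0 < (MIN a\<in>{1..m}. ?q a)"
      using m supp supp' by (subst Min_gr_iff) auto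
    show "(MIN a\<in>{1..m}. ?q a) \<le> \<P>(w in M. A w = a)" if "a \<in> {1..m}" for a
      using that by (intro order_trans[OF Min_le[of _ "?q a"]]) auto
  next
    let ?q = "\<lambda>a. \<P>(w in M. A w = a)"
    assume *: "\<forall>a\<in>{1..m}. \<P>(w in M. A w = a) > \<eta>"
    have "\<eta> < (MIN a\<in>{1..m}. ?q a)"
      using m * by (subst Min_gr_iff) auto
    \<comment> \<open>The extra hypothesis makes this \<open>q\<close> positive, and \<eta> > 0
      keeps it below every \<open>Pr(A = a)\<close>.\<close>
    then show "0 < (MIN a\<in>{1..m}. ?q a) - \<eta>" by simp
    show "(MIN a\<in>{1..m}. ?q a) - \<eta> \<le> ?q a" if "a \<in> {1..m}" for a
    proof -
      have "(MIN a\<in>{1..m}. ?q a) \<le> ?q a" using that by (intro Min_le) auto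
      with \<open>\<eta> > 0\<close> show ?thesis by simp
    qed
  qed
qed

end
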